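(* Let $p_1,\dots,p_5$ be five points in the projective plane over $\mathbb{K}\in\{\mathbb{R},\mathbb{C}\}$, no three collinear, and let $C$ be the unique conic through them. Construct: $P$ = intersection of the lines $p_1p_4$ and $p_2p_5$; $Q$ = intersection of $p_1p_2$ and $p_4p_5$; $R$ = intersection of $p_2p_4$ and $p_3Q$; $l$ = the line through $R$ and $P$. Let $p_7$ be an intersection point of $l$ with $C$, and assume all construction steps are well defined (non-degenerate). Then $p_7$ is a valid seventh point for a Poncelet octagon, i.e. there are points $p_6,p_8$ on $C$ such that $p_1,\dots,p_8$ is a Poncelet octagon with circumscribed conic $C$.
   Context: Poncelet chains: given conics $\mathcal{A}$ (outer) and $\mathcal{B}$ (inner), a Poncelet chain is a sequence $p_1,p_2,\dots$ of points on $\mathcal{A}$ obtained as follows: $l_1$ is a tangent to $\mathcal{B}$ through $p_1$; $p_{i+1}$ is the intersection of $l_i$ with $\mathcal{A}$ other than $p_i$; $l_{i+1}$ is the tangent to $\mathcal{B}$ through $p_{i+1}$ other than $l_i$. If the chain closes after $8$ steps ($p_{i+8}=p_i$ for all $i$), then $p_1,\dots,p_8$ is a Poncelet octagon.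
   Formalization: Besides well-defined construction steps, it is assumed that p7 differs from p3 and that X = p1p5 ∩ p3p7 is not conjugate w.r.t. C to both p2 and p4, nor to both p1p2 ∩ p3p4 and p2p3 ∩ p4p5; in these special positions no octagon with nondegenerate inscribed conic exists. *)

theory Defs
  imports "HOL-Analysis.Analysis"
begin

text \<open>
  Points and lines of the projective plane over \<open>'k\<close> are represented by nonzero vectors of
  homogeneous coordinates, considered up to \<^term>\<open>proj_eq\<close>.  The sort
  \<open>{real_normed_field, euclidean_space}\<close> expresses that the ground field is \<open>\<real>\<close> or \<open>\<complex>\<close>:
  \<^typ>\<open>real\<close> and \<^typ>\<open>complex\<close> are instances, and by Frobenius' theorem every instance is
  isomorphic to one of them.
\<close>

definition proj_eq :: "'k::field ^ 3 \<Rightarrow> 'k ^ 3 \<Rightarrow> bool" where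
  "proj_eq u v \<longleftrightarrow> (\<exists>c. c \<noteq> 0 \<and> v = c *s u)"

text \<open>The bilinear pairing; over \<open>\<complex>\<close> it must not be confused with the real inner product.\<close>

definition pairing :: "'k::field ^ 3 \<Rightarrow> 'k ^ 3 \<Rightarrow> 'k" where
  "pairing u v = (\<Sum>i\<in>UNIV. u $ i * v $ i)"

definition incident :: "'k::field ^ 3 \<Rightarrow> 'k ^ 3 \<Rightarrow> bool" where
  "incident l x \<longleftrightarrow> pairing l x = 0"

definition collinear3 :: "'k::field ^ 3 \<Rightarrow> 'k ^ 3 \<Rightarrow> 'k ^ 3 \<Rightarrow> bool" where
  "collinear3 x y z \<longleftrightarrow> (\<exists>l. l \<noteq> 0 \<and> incident l x \<and> incident l y \<and> incident l z)"

definition no_three_collinear :: "('k::field ^ 3) list \<Rightarrow> bool" where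
  "no_three_collinear ps \<longleftrightarrow>
     (\<forall>i j k. i < j \<and> j < k \<and> k < length ps \<longrightarrow> \<not> collinear3 (ps ! i) (ps ! j) (ps ! k))"

text \<open>The next two predicates include that the join and the intersection are well defined.\<close>

definition is_join :: "'k::field ^ 3 \<Rightarrow> 'k ^ 3 \<Rightarrow> 'k ^ 3 \<Rightarrow> bool" where
  "is_join l x y \<longleftrightarrow> l \<noteq> 0 \<and> \<not> proj_eq x y \<and> incident l x \<and> incident l y"

definition is_meet :: "'k::field ^ 3 \<Rightarrow> 'k ^ 3 \<Rightarrow> 'k ^ 3 \<Rightarrow> 'k ^ 3 \<Rightarrow> 'k ^ 3 \<Rightarrow> bool" where
  "is_meet X a b c d \<longleftrightarrow> X \<noteq> 0 \<and>
     (\<exists>l m. is_join l a b \<and> is_join m c d \<and> \<not> proj_eq l m \<and> incident l X \<and> incident m X)"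

text \<open>A conic is given by a nonzero symmetric matrix.\<close>

definition is_conic :: "'k::field ^ 3 ^ 3 \<Rightarrow> bool" where
  "is_conic A \<longleftrightarrow> A \<noteq> 0 \<and> transpose A = A"

definition nondegenerate_conic :: "'k::field ^ 3 ^ 3 \<Rightarrow> bool" where
  "nondegenerate_conic A \<longleftrightarrow> is_conic A \<and> det A \<noteq> 0"

definition conjugate_wrt :: "'k::field ^ 3 ^ 3 \<Rightarrow> 'k ^ 3 \<Rightarrow> 'k ^ 3 \<Rightarrow> bool" where
  "conjugate_wrt A x y \<longleftrightarrow> pairing x (A *v y) = 0"

definition on_conic :: "'k::field ^ 3 ^ 3 \<Rightarrow> 'k ^ 3 \<Rightarrow> bool" where
  "on_conic A x \<longleftrightarrow> x \<noteq> 0 \<and> conjugate_wrt A x x"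

definition tangent_at :: "'k::field ^ 3 ^ 3 \<Rightarrow> 'k ^ 3 \<Rightarrow> 'k ^ 3 \<Rightarrow> bool" where
  "tangent_at A x l \<longleftrightarrow> on_conic A x \<and> l \<noteq> 0 \<and> proj_eq (A *v x) l"

definition tangent :: "'k::field ^ 3 ^ 3 \<Rightarrow> 'k ^ 3 \<Rightarrow> bool" where
  "tangent A l \<longleftrightarrow> (\<exists>x. tangent_at A x l)"

definition poncelet_chain ::
    "'k::field ^ 3 ^ 3 \<Rightarrow> 'k ^ 3 ^ 3 \<Rightarrow> (nat \<Rightarrow> 'k ^ 3) \<Rightarrow> bool" where
  "poncelet_chain A B p \<longleftrightarrow> nondegenerate_conic A \<and> nondegenerate_conic B \<and>
     (\<exists>l. \<forall>i\<ge>1. on_conic A (p i) \<and> tangent B (l i) \<and>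
        incident (l i) (p i) \<and> incident (l i) (p (i + 1)) \<and>
        \<not> proj_eq (p (i + 1)) (p i) \<and> \<not> proj_eq (l (i + 1)) (l i))"

definition poncelet_octagon :: "'k::field ^ 3 ^ 3 \<Rightarrow> ('k ^ 3) list \<Rightarrow> bool" where
  "poncelet_octagon A ps \<longleftrightarrow> length ps = 8 \<and>
     (\<exists>B p. poncelet_chain A B p \<and>
        (\<forall>i\<ge>1. proj_eq (p (i + 8)) (p i)) \<and>
        (\<forall>i<8. proj_eq (p (i + 1)) (ps ! i)))"

text \<open>
  For special positions of the five points, a point \<open>p\<^sub>7\<close> obtained by the construction corresponds
  to a degenerate inscribed conic.  In a Poncelet octagon the diagonals
  \<open>p\<^sub>1p\<^sub>5\<close> and \<open>p\<^sub>3p\<^sub>7\<close> meet in a point \<open>X\<close> having the same polar line with respect to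
  both conics.  If the inscribed conic degenerates to a pair of points (as an envelope of lines),
  these two points are opposite vertices of the quadrilateral formed by the four sides
  \<open>p\<^sub>1p\<^sub>2, p\<^sub>2p\<^sub>3, p\<^sub>3p\<^sub>4, p\<^sub>4p\<^sub>5\<close> and span the polar of \<open>X\<close>.  The pairs to be avoided are
  \<open>p\<^sub>2, p\<^sub>4\<close> and \<open>U, V\<close> below.  (The third pair, \<open>p\<^sub>3\<close> and
  \<open>p\<^sub>1p\<^sub>2 \<inter> p\<^sub>4p\<^sub>5\<close>, does not arise when \<open>p\<^sub>7 \<noteq> p\<^sub>3\<close>.)  In the case \<open>p\<^sub>7 = p\<^sub>3\<close> the chain
  would run back on itself, the points \<open>p\<^sub>1\<close> and \<open>p\<^sub>5\<close> lying on both conics.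
\<close>

definition nondegenerate_seventh ::
    "'k::field ^ 3 ^ 3 \<Rightarrow> 'k ^ 3 \<Rightarrow> 'k ^ 3 \<Rightarrow> 'k ^ 3 \<Rightarrow> 'k ^ 3 \<Rightarrow> 'k ^ 3 \<Rightarrow> 'k ^ 3 \<Rightarrow> bool" where
  "nondegenerate_seventh C p1 p2 p3 p4 p5 p7 \<longleftrightarrow> \<not> proj_eq p3 p7 \<and>
     (\<forall>X U V. is_meet X p1 p5 p3 p7 \<and> is_meet U p1 p2 p3 p4 \<and> is_meet V p2 p3 p4 p5 \<longrightarrow>
        \<not> (conjugate_wrt C X p2 \<and> conjugate_wrt C X p4) \<and>
        \<not> (conjugate_wrt C X U \<and> conjugate_wrt C X V))"

end

theory Submission
  imports Defs
begin

text \<open>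
  In coordinates with \<open>p\<^sub>2 = (0,0,1)\<close>, \<open>p\<^sub>3 = (1,1,1)\<close>, \<open>p\<^sub>4 = (1,0,0)\<close> and
  \<open>C: x z = y\<^sup>2\<close>, the points of \<open>C\<close> are \<open>(x\<^sup>2, x y, y\<^sup>2)\<close>, and
  \<open>p\<^sub>1, p\<^sub>5, p\<^sub>7\<close> have parameters \<open>y/x = a, c, s\<close>.  The construction amounts to a quadratic
  equation for \<open>s\<close>.

  Let \<open>X = p\<^sub>1p\<^sub>5 \<inter> p\<^sub>3p\<^sub>7\<close> and let \<open>W\<close> be its polar line with respect to \<open>C\<close>.  The harmonic
  homology with centre \<open>X\<close> and axis \<open>W\<close> preserves \<open>C\<close> and swaps \<open>p\<^sub>1, p\<^sub>5\<close> and \<open>p\<^sub>3, p\<^sub>7\<close>;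
  define \<open>p\<^sub>6, p\<^sub>8\<close> as the images of \<open>p\<^sub>2, p\<^sub>4\<close>.  The dual conics \<open>D\<close> touching the four sides
  \<open>p\<^sub>1p\<^sub>2, \<dots>, p\<^sub>4p\<^sub>5\<close> form a pencil, and the quadratic equation for \<open>s\<close> is the condition that some
  \<open>D\<close> in it satisfies \<open>D W = r X\<close>.  Such a \<open>D\<close> is invariant under the homology, hence also touches
  the other four sides, and its inverse is the inscribed conic.  The degenerate members of the
  pencil are excluded by the nondegeneracy hypothesis.
\<close>

subsection \<open>Change of projective coordinates\<close>

lemma pairing_3: "pairing u v = u$1 * v$1 + u$2 * v$2 + u$3 * v$3"
  by (simp add: pairing_def sum_3)

lemma pairing_matrix_vector_mult:
  "pairing (transpose A *v x) y = pairing x ((A :: 'k::field^3^3) *v y)"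
  by (simp add: pairing_3 matrix_vector_mult_def transpose_def sum_3 algebra_simps)

lemma pairing_smult: "pairing (c *s u) (d *s v) = c * d * pairing u v"
  by (simp add: pairing_3 algebra_simps)

lemma proj_eq_smult: "c \<noteq> 0 \<Longrightarrow> proj_eq x (c *s x)"
  by (auto simp: proj_eq_def)

lemma proj_eq_minor:
  assumes "proj_eq u v"
  shows "u $ i * v $ j = u $ j * v $ i"
  using assms by (auto simp: proj_eq_def)

text \<open>Points transform by \<open>M\<close>, lines and conics by its inverse \<open>N\<close>.\<close>

locale coordinate_change =
  fixes M N :: "'k::field ^ 3 ^ 3"
  assumes MN: "M ** N = mat 1" and NM: "N ** M = mat 1"
begin

lemma inverse: "coordinate_change N M"
  using MN NM by unfold_locales

lemma M_N [simp]: "M *v (N *v x) = x" "N *v (M *v x) = x"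
  by (simp_all add: matrix_vector_mul_assoc MN NM)

lemma transpose_M_N [simp]:
  "transpose M *v (transpose N *v x) = x" "transpose N *v (transpose M *v x) = x"
proof -
  have "transpose M ** transpose N = mat 1" "transpose N ** transpose M = mat 1"
    by (simp_all only: matrix_transpose_mul[symmetric] MN NM transpose_mat)
  then show "transpose M *v (transpose N *v x) = x" "transpose N *v (transpose M *v x) = x"
    by (simp_all add: matrix_vector_mul_assoc del: transpose_matrix_vector)
qed

text \<open>\<open>M\<close> is onto, so bound points and lines can be pulled back along it; this
  yields the invariance of predicates that quantify over them.\<close>

lemma all_point: "(\<forall>x. F x) \<longleftrightarrow> (\<forall>x. F (M *v x))"
  by (metis M_N(1))

lemma ex_line: "(\<exists>l. F l) \<longleftrightarrow> (\<exists>l. F (transpose N *v l))"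
  by (metis transpose_M_N(2))

lemma point_eq_0_iff [simp]: "M *v x = 0 \<longleftrightarrow> x = 0"
  by (metis M_N(2) matrix_vector_mult_0_right)

lemma line_eq_0_iff [simp]: "transpose N *v x = 0 \<longleftrightarrow> x = 0"
  by (metis transpose_M_N(1) matrix_vector_mult_0_right)

lemma proj_eq_point [simp]: "proj_eq (M *v x) (M *v y) \<longleftrightarrow> proj_eq x y"
  unfolding proj_eq_def by (metis M_N(2) vector_scalar_commute)

lemma proj_eq_line [simp]: "proj_eq (transpose N *v x) (transpose N *v y) \<longleftrightarrow> proj_eq x y"
  unfolding proj_eq_def by (metis transpose_M_N(1) vector_scalar_commute)

lemma incident_line_point [simp]: "incident (transpose N *v l) (M *v x) \<longleftrightarrow> incident l x"
  by (simp add: incident_def pairing_matrix_vector_mult del: transpose_matrix_vector)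

text \<open>The image of the conic \<open>A\<close> under \<open>M\<close> has matrix
  \<open>transpose N ** A ** N\<close>, and polar lines are carried along.\<close>

lemma conic_point: "(transpose N ** A ** N) *v (M *v x) = transpose N *v (A *v x)"
  by (simp add: matrix_vector_mul_assoc[symmetric] del: transpose_matrix_vector)

lemma conjugate_wrt_point [simp]:
  "conjugate_wrt (transpose N ** A ** N) (M *v x) (M *v y) \<longleftrightarrow> conjugate_wrt A x y"
proof -
  have "pairing (M *v x) (transpose N *v (A *v y)) = pairing x (A *v y)"
    by (metis transpose_transpose pairing_matrix_vector_mult M_N(2))
  then show ?thesis
    by (simp add: conjugate_wrt_def conic_point del: transpose_matrix_vector)
qed

lemma on_conic_point [simp]: "on_conic (transpose N ** A ** N) (M *v x) \<longleftrightarrow> on_conic A x"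
  by (simp add: on_conic_def)

lemma is_join_point [simp]: "is_join (transpose N *v l) (M *v x) (M *v y) \<longleftrightarrow> is_join l x y"
  by (simp add: is_join_def del: transpose_matrix_vector)

lemma is_meet_point [simp]:
  "is_meet (M *v X) (M *v a) (M *v b) (M *v c) (M *v d) \<longleftrightarrow> is_meet X a b c d"
  unfolding is_meet_def
  by (subst ex_line, subst (2) ex_line) (simp del: transpose_matrix_vector)

lemma collinear3_point [simp]: "collinear3 (M *v x) (M *v y) (M *v z) \<longleftrightarrow> collinear3 x y z"
  unfolding collinear3_def by (subst ex_line) (simp del: transpose_matrix_vector)

lemma no_three_collinear_point:
  "no_three_collinear (map ((*v) M) ps) \<longleftrightarrow> no_three_collinear ps"
  by (auto simp: no_three_collinear_def)

lemma nondegenerate_seventh_point: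
  "nondegenerate_seventh (transpose N ** A ** N)
     (M *v p1) (M *v p2) (M *v p3) (M *v p4) (M *v p5) (M *v p7) \<longleftrightarrow>
   nondegenerate_seventh A p1 p2 p3 p4 p5 p7"
  unfolding nondegenerate_seventh_def
  by (subst all_point, subst (2) all_point, subst (3) all_point) simp

lemma nondegenerate_conic_point:
  assumes "nondegenerate_conic A"
  shows "nondegenerate_conic (transpose N ** A ** N)"
proof -
  have "det N * det M = 1"
    using NM by (metis det_I det_mul)
  then have "det N \<noteq> 0"
    by auto
  then have "det (transpose N ** A ** N) \<noteq> 0"
    using assms by (simp add: nondegenerate_conic_def det_mul)
  moreover from this have "transpose N ** A ** N \<noteq> 0"
    by (metis det_0 mat_0)
  ultimately show ?thesis
    using assms by (simp add: nondegenerate_conic_def is_conic_def matrix_transpose_mul matrix_mul_assoc)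
qed

lemma tangent_line:
  assumes "tangent A l"
  shows "tangent (transpose N ** A ** N) (transpose N *v l)"
proof -
  obtain x where "tangent_at A x l"
    using assms by (auto simp: tangent_def)
  then have "tangent_at (transpose N ** A ** N) (M *v x) (transpose N *v l)"
    by (simp add: tangent_at_def conic_point del: transpose_matrix_vector)
  then show ?thesis
    unfolding tangent_def by blast
qed

lemma poncelet_octagon_point:
  assumes "poncelet_octagon A ps"
  shows "poncelet_octagon (transpose N ** A ** N) (map ((*v) M) ps)"
proof -
  obtain B p where chain: "poncelet_chain A B p"
    and p: "\<forall>i\<ge>1. proj_eq (p (i + 8)) (p i)" "\<forall>i<8. proj_eq (p (i + 1)) (ps ! i)"
      "length ps = 8"
    using assms by (auto simp: poncelet_octagon_def)
  from chain obtain l where l: "\<forall>i\<ge>1. on_conic A (p i) \<and> tangent B (l i) \<and>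
        incident (l i) (p i) \<and> incident (l i) (p (i + 1)) \<and>
        \<not> proj_eq (p (i + 1)) (p i) \<and> \<not> proj_eq (l (i + 1)) (l i)"
    and nd: "nondegenerate_conic A" "nondegenerate_conic B"
    unfolding poncelet_chain_def by blast
  have "poncelet_chain (transpose N ** A ** N) (transpose N ** B ** N) (\<lambda>i. M *v p i)"
    unfolding poncelet_chain_def
    using l nd
    by (intro conjI exI[of _ "\<lambda>i. transpose N *v l i"])
      (simp_all add: nondegenerate_conic_point tangent_line del: transpose_matrix_vector)
  then show ?thesis
    unfolding poncelet_octagon_def using p
    by (intro conjI exI[of _ "transpose N ** B ** N"] exI[of _ "\<lambda>i. M *v p i"]) simp_all
qed

end

subsection \<open>Tangents and Poncelet chains\<close>

text \<open>The pole of \<open>l\<close> with respect to \<open>B\<close> is \<open>D *v l\<close>.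
  The dual equation puts this pole on its own polar, hence on \<open>B\<close>, so it is the point
  of contact.\<close>

lemma tangent_if_dual_conic:
  fixes D B :: "'k::field ^ 3 ^ 3"
  assumes "B ** D = mat 1" and "l \<noteq> 0" and "pairing l (D *v l) = 0"
  shows "tangent B l"
proof -
  have B: "B *v (D *v l) = l"
    using assms(1) by (simp add: matrix_vector_mul_assoc)
  then have "D *v l \<noteq> 0"
    using assms(2) by auto
  moreover have "pairing (D *v l) l = 0"
    using assms(3) by (simp add: pairing_def mult.commute)
  moreover have "proj_eq l l"
    using proj_eq_smult[of 1 l] by simp
  ultimately have "tangent_at B (D *v l) l"
    using assms(2) by (simp add: tangent_at_def on_conic_def conjugate_wrt_def B)
  then show ?thesis
    by (auto simp: tangent_def)
qed

lemma poncelet_octagonI: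
  fixes A B :: "'k::field ^ 3 ^ 3" and u m :: "nat \<Rightarrow> 'k ^ 3"
  assumes "nondegenerate_conic A" "nondegenerate_conic B" and "length ps = 8"
    and "\<And>i. i < 8 \<Longrightarrow> on_conic A (u i)"
    and "\<And>i. i < 8 \<Longrightarrow> tangent B (m i)"
    and "\<And>i. i < 8 \<Longrightarrow> incident (m i) (u i)"
    and "\<And>i. i < 8 \<Longrightarrow> incident (m i) (u (Suc i mod 8))"
    and "\<And>i. i < 8 \<Longrightarrow> \<not> proj_eq (u (Suc i mod 8)) (u i)"
    and "\<And>i. i < 8 \<Longrightarrow> \<not> proj_eq (m (Suc i mod 8)) (m i)"
    and "\<And>i. i < 8 \<Longrightarrow> proj_eq (u i) (ps ! i)"
  shows "poncelet_octagon A ps"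
proof -
  \<comment> \<open>The chain is numbered from 1, the data from 0. At \<open>i = 0\<close> truncated
    subtraction gives the default \<open>u 0\<close>; the chain imposes no condition there.\<close>
  define p where "p i = u ((i - 1) mod 8)" for i
  define l where "l i = m ((i - 1) mod 8)" for i
  have Suc: "p (i + 1) = u (Suc ((i - 1) mod 8) mod 8)" "l (i + 1) = m (Suc ((i - 1) mod 8) mod 8)"
    if "i \<ge> 1" for i
    using that by (simp_all add: p_def l_def mod_Suc_eq)
  have "poncelet_chain A B p"
    unfolding poncelet_chain_def
    using assms
    by (intro conjI exI[of _ l] allI impI; (simp only: Suc)?) (simp_all add: p_def l_def)
  moreover have "\<forall>i\<ge>1. proj_eq (p (i + 8)) (p i)"
  proof (intro allI impI)
    fix i :: nat
    assume "i \<ge> 1"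
    then have "i + 8 - 1 = (i - 1) + 8"
      by simp
    then have "p (i + 8) = p i"
      unfolding p_def by (metis mod_add_self2)
    then show "proj_eq (p (i + 8)) (p i)"
      using proj_eq_smult[of 1 "p i"] by simp
  qed
  moreover have "\<forall>i<8. proj_eq (p (i + 1)) (ps ! i)"
    using assms by (simp add: p_def)
  ultimately show ?thesis
    unfolding poncelet_octagon_def using assms(3) by blast
qed

subsection \<open>The conic in standard position\<close>

definition conic_point :: "'k::field \<Rightarrow> 'k \<Rightarrow> 'k ^ 3" where
  "conic_point x y = vector [x\<^sup>2, x * y, y\<^sup>2]"

text \<open>Paired with \<open>conic_point X Y\<close> this gives
  \<open>(y * X - x * Y) * (y' * X - x' * Y)\<close>: the line through the points with parameters
  \<open>(x, y)\<close> and \<open>(x', y')\<close>.\<close>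

definition chord :: "'k::field \<Rightarrow> 'k \<Rightarrow> 'k \<Rightarrow> 'k \<Rightarrow> 'k ^ 3" where
  "chord x y x' y' = vector [y * y', - (x * y' + x' * y), x * x']"

text \<open>A conic is a matrix, not a class up to scaling, so the factor \<open>n\<close> has to be
  carried along.\<close>

definition std_conic :: "'k::field \<Rightarrow> 'k ^ 3 ^ 3" where
  "std_conic n = vector [vector [0, 0, n], vector [0, - 2 * n, 0], vector [n, 0, 0]]"

lemma incident_3: "incident u v \<longleftrightarrow> u$1 * v$1 + u$2 * v$2 + u$3 * v$3 = 0"
  by (simp add: incident_def pairing_3)

lemma vector_eq_0_iff: "(u :: 'k::field ^ 3) = 0 \<longleftrightarrow> u$1 = 0 \<and> u$2 = 0 \<and> u$3 = 0"
  by (simp add: vec_eq_iff forall_3)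

lemma conjugate_wrt_std_conic:
  assumes "n \<noteq> 0"
  shows "conjugate_wrt (std_conic n) u v \<longleftrightarrow> u$1 * v$3 - 2 * u$2 * v$2 + u$3 * v$1 = 0"
proof -
  have "pairing u (std_conic n *v v) = n * (u$1 * v$3 - 2 * u$2 * v$2 + u$3 * v$1)"
    by (simp add: pairing_3 std_conic_def matrix_vector_mult_def sum_3 algebra_simps)
  then show ?thesis
    using assms by (simp add: conjugate_wrt_def)
qed

lemma nondegenerate_std_conic:
  fixes n :: "'k::field_char_0"
  assumes "n \<noteq> 0"
  shows "nondegenerate_conic (std_conic n)"
proof -
  have "det (std_conic n) \<noteq> 0"
    using assms by (simp add: det_3 std_conic_def)
  moreover from this have "std_conic n \<noteq> 0"
    by (metis det_0 mat_0)
  moreover have "transpose (std_conic n) = std_conic n"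
    by (simp add: std_conic_def transpose_def vec_eq_iff forall_3)
  ultimately show ?thesis
    by (simp add: nondegenerate_conic_def is_conic_def)
qed

lemma conic_point_nonzero: "conic_point x y \<noteq> 0 \<longleftrightarrow> x \<noteq> 0 \<or> y \<noteq> 0"
  by (auto simp: conic_point_def vector_eq_0_iff)

lemma on_std_conic_point:
  assumes "n \<noteq> 0" "x \<noteq> 0 \<or> y \<noteq> 0"
  shows "on_conic (std_conic n) (conic_point x y)"
  unfolding on_conic_def conjugate_wrt_std_conic[OF assms(1)]
  using assms(2) by (simp add: conic_point_nonzero) (simp add: conic_point_def power2_eq_square)

lemma incident_chord:
  "incident (chord x y x' y') (conic_point x y)" "incident (chord x y x' y') (conic_point x' y')"
  by (simp_all add: incident_3 chord_def conic_point_def power2_eq_square algebra_simps)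

lemma not_proj_eq_conic_point:
  assumes "x * y' \<noteq> x' * y"
  shows "\<not> proj_eq (conic_point x y) (conic_point x' y')"
proof
  assume eq: "proj_eq (conic_point x y) (conic_point x' y')"
  have "x\<^sup>2 * y'\<^sup>2 = y\<^sup>2 * x'\<^sup>2" "x\<^sup>2 * (x' * y') = x * y * x'\<^sup>2" "x * y * y'\<^sup>2 = y\<^sup>2 * (x' * y')"
    using proj_eq_minor[OF eq, of 1 3] proj_eq_minor[OF eq, of 1 2] proj_eq_minor[OF eq, of 2 3]
    by (simp_all add: conic_point_def)
  then have "(x * y' - x' * y) ^ 4 = 0"
    by algebra
  then show False
    using assms by simp
qed

lemma chord_nonzero:
  assumes "x * y' \<noteq> x' * y"
  shows "chord x y x' y' \<noteq> 0"
  using assms by (auto simp: chord_def vector_eq_0_iff)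

text \<open>The chords share the endpoint \<open>(x, y)\<close>; up to sign their minors are
  \<open>u * v' - u' * v\<close> times the coordinates of \<open>conic_point x y\<close>.\<close>

lemma not_proj_eq_chord:
  assumes "x \<noteq> 0 \<or> y \<noteq> 0" and "u * v' \<noteq> u' * v"
  shows "\<not> proj_eq (chord x y u' v') (chord u v x y)"
proof
  assume eq: "proj_eq (chord x y u' v') (chord u v x y)"
  have eqs: "y * v' * (u * x) = x * u' * (v * y)"
    "y * v' * - (u * y + x * v) = - (x * v' + u' * y) * (v * y)"
    "- (x * v' + u' * y) * (u * x) = x * u' * - (u * y + x * v)"
    using proj_eq_minor[OF eq, of 1 3] proj_eq_minor[OF eq, of 1 2] proj_eq_minor[OF eq, of 2 3]
    by (simp_all only: chord_def vector_3)
  have "x\<^sup>2 * (u * v' - u' * v) = 0" "y\<^sup>2 * (u * v' - u' * v) = 0"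
    using eqs by algebra+
  then show False
    using assms by auto
qed

lemma is_join_chord:
  assumes "x * y' \<noteq> x' * y" "k \<noteq> 0" "k' \<noteq> 0"
  shows "is_join (chord x y x' y') (k *s conic_point x y) (k' *s conic_point x' y')"
proof -
  have "\<not> proj_eq (k *s conic_point x y) (k' *s conic_point x' y')"
  proof
    assume "proj_eq (k *s conic_point x y) (k' *s conic_point x' y')"
    then obtain c where c: "c \<noteq> 0" "k' *s conic_point x' y' = c *s (k *s conic_point x y)"
      by (auto simp: proj_eq_def)
    have "conic_point x' y' = (1 / k') *s (k' *s conic_point x' y')"
      using assms by simp
    also have "\<dots> = (c * k / k') *s conic_point x y"
      unfolding c(2) by simp
    finally have "proj_eq (conic_point x y) (conic_point x' y')"
      unfolding proj_eq_def using c assms by (intro exI[of _ "c * k / k'"]) simp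
    then show False
      using not_proj_eq_conic_point[OF assms(1)] by simp
  qed
  moreover have "incident l (r *s x)" if "incident l x" for r and l x :: "'a ^ 3"
  proof -
    have "pairing l (r *s x) = r * pairing l x"
      by (simp add: pairing_3 algebra_simps)
    then show ?thesis
      using that by (simp add: incident_def)
  qed
  ultimately show ?thesis
    by (simp add: is_join_def incident_chord chord_nonzero[OF assms(1)])
qed

text \<open>
  Up to a factor, \<open>m\<close> is the image of \<open>l\<close> under the harmonic homology with centre \<open>X\<close> and axis \<open>W\<close>.
\<close>

lemma reflection_dual_conic:
  fixes D :: "'k::field ^ 3 ^ 3" and X W l :: "'k ^ 3"
  assumes D: "transpose D = D" "D *v W = r *s X" and l: "pairing l (D *v l) = 0"
    and m: "k *s m = pairing X W *s l - (2 * pairing l X) *s W" and "k \<noteq> 0"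
  shows "pairing m (D *v m) = 0"
proof -
  have W: "pairing W (D *v l) = r * pairing l X"
    using pairing_matrix_vector_mult[of D W l] D by (simp add: pairing_3 algebra_simps)
  have "k *s (D *v m) = D *v (k *s m)"
    by (simp add: vector_scalar_commute)
  also have "\<dots> = pairing X W *s (D *v l) - (2 * pairing l X * r) *s X"
    unfolding m by (simp add: matrix_vector_mult_diff_distrib vector_scalar_commute D)
  finally have "k\<^sup>2 * pairing m (D *v m) = pairing (k *s m) (pairing X W *s (D *v l) - (2 * pairing l X * r) *s X)"
    by (metis (no_types, lifting) mult.assoc power2_eq_square pairing_smult)
  also have "\<dots> = (pairing X W)\<^sup>2 * pairing l (D *v l) - 2 * pairing X W * pairing l X * pairing W (D *v l)
      - 2 * pairing l X * r * (pairing X W * pairing l X - 2 * pairing l X * pairing X W)"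
    unfolding m by (simp add: pairing_3 power2_eq_square algebra_simps)
  \<comment> \<open>The remaining terms are \<open>-2\<close> and \<open>2\<close> times
    \<open>r * pairing X W * (pairing l X)\<^sup>2\<close>.\<close>
  also have "\<dots> = 0"
    unfolding W l by (simp add: algebra_simps)
  finally show ?thesis
    using \<open>k \<noteq> 0\<close> by simp
qed

subsection \<open>The octagon in standard position\<close>

text \<open>The parameters of \<open>p2\<close>, \<open>p3\<close>, \<open>p4\<close> are infinity,
  1 and 0, so the inequalities say that the five given points are distinct and \<open>p7\<close>
  differs from \<open>p3\<close>.\<close>

locale seventh_point =
  fixes a c s :: "'k::field_char_0"
  assumes a: "a \<noteq> 0" "a \<noteq> 1" and c: "c \<noteq> 0" "c \<noteq> 1" and ac: "a \<noteq> c" and s1: "s \<noteq> 1"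
    and seventh: "c * (1 - a) * s\<^sup>2 - a * (1 - a * c) * s + a * c * (1 - c) = 0"
begin

text \<open>\<open>(x0, x1, x2)\<close> is the meet \<open>X\<close> of \<open>p\<^sub>1p\<^sub>5\<close> and \<open>p\<^sub>3p\<^sub>7\<close>; its polar \<open>W\<close> is \<open>(x2, - 2 * x1, x0)\<close>.\<close>

definition x0 where "x0 = 1 + s - a - c"
definition x1 where "x1 = s - a * c"
definition x2 where "x2 = s * (a + c) - a * c * (1 + s)"

lemmas x_defs = x0_def x1_def x2_def

lemma s_neq: "s \<noteq> 0" "s \<noteq> a" "s \<noteq> c"
proof -
  show "s \<noteq> 0"
    using seventh a c by auto
  show "s \<noteq> a"
  proof
    assume "s = a"
    have "a * ((c - 1) * (a - c)) = c * (1 - a) * a\<^sup>2 - a * (1 - a * c) * a + a * c * (1 - c)"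
      by (simp add: algebra_simps power2_eq_square)
    also have "\<dots> = 0"
      using seventh unfolding \<open>s = a\<close> .
    finally have "a * ((c - 1) * (a - c)) = 0" .
    then show False
      using a c ac by auto
  qed
  show "s \<noteq> c"
  proof
    assume "s = c"
    have "c\<^sup>2 * ((c - a) * (1 - a)) = c * (1 - a) * c\<^sup>2 - a * (1 - a * c) * c + a * c * (1 - c)"
      by (simp add: algebra_simps power2_eq_square)
    also have "\<dots> = 0"
      using seventh unfolding \<open>s = c\<close> .
    finally have "c\<^sup>2 * ((c - a) * (1 - a)) = 0" .
    then show False
      using a c ac by auto
  qed
qed

text \<open>\<open>x1 = 0\<close> would put \<open>X\<close> on the line \<open>p2 p4\<close>; the
  quadratic then forces \<open>a * c = 1\<close> and so \<open>s = 1\<close>.\<close>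

lemma x1_nonzero: "x1 \<noteq> 0"
proof
  assume "x1 = 0"
  then have "s = a * c"
    by (simp add: x1_def)
  then have "a * c * ((1 - a) * ((1 - c) * (1 - a * c))) = 0"
    using seventh by algebra
  then have "a * c = 1"
    using a c by auto
  with \<open>s = a * c\<close> s1 show False
    by simp
qed

text \<open>The first five compare the parameters \<open>(x0, x1)\<close> of \<open>p6\<close> with
  \<open>p1\<close>, \<open>p5\<close>, \<open>p7\<close>, and \<open>(x1, x2)\<close> of
  \<open>p8\<close> with \<open>p7\<close>, \<open>p1\<close>. The last two decide whether
  \<open>X\<close> is on the conic and whether it is conjugate to \<open>p3\<close>.\<close>

lemma x_relations:
  "x1 - a * x0 = (s - a) * (1 - a)"
  "x1 - c * x0 = (s - c) * (1 - c)"
  "s * x0 - x1 = (s - a) * (s - c)"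
  "x2 - s * x1 = (s - a) * (c - s)"
  "a * x1 - x2 = c * (a - s) * (1 - a)"
  "x0 * x2 - x1\<^sup>2 = (1 - a) * (1 - c) * (a - s) * (s - c)"
  "x0 - 2 * x1 + x2 = (1 - a) * (1 - c) * (1 - s)"
  by (simp_all add: x_defs algebra_simps power2_eq_square)

lemma x_nonzero:
  "x1 - a * x0 \<noteq> 0" "x1 - c * x0 \<noteq> 0" "s * x0 - x1 \<noteq> 0" "x2 - s * x1 \<noteq> 0" "a * x1 - x2 \<noteq> 0"
  "x0 * x2 - x1\<^sup>2 \<noteq> 0" "x0 - 2 * x1 + x2 \<noteq> 0"
  unfolding x_relations using a c s_neq s1 by auto

text \<open>The outer rows of \<open>D W = r X\<close> prescribe \<open>(h - r) * x0\<close> and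
  \<open>(h - r) * x2\<close>. Eliminating \<open>h - r\<close> leaves this equation, a multiple of
  the quadratic for \<open>s\<close>.\<close>

lemma consistent: "x2 * ((1 + a) * x1 - x2) = x0 * (a * (1 + c) * x1 - a * c * x0)"
proof -
  have "x2 * ((1 + a) * x1 - x2) - x0 * (a * (1 + c) * x1 - a * c * x0)
      = (1 - a) * (1 - c) * (c * (1 - a) * s\<^sup>2 - a * (1 - a * c) * s + a * c * (1 - c))"
    by (simp add: x_defs algebra_simps power2_eq_square)
  then show ?thesis
    using seventh by auto
qed

text \<open>
  The dual conics touching the four sides, apart from the point pair \<open>p\<^sub>2, p\<^sub>4\<close>, are the matrices
  \<open>D\<close> with rows \<open>(2, 1 + a, h)\<close>, \<open>(1 + a, 2 a, a (1 + c))\<close>, \<open>(h, a (1 + c), 2 a c)\<close>, and the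
  equations below say \<open>D W = r X\<close>.  The pair \<open>p\<^sub>3, Q\<close> is \<open>h = 1 + a c\<close>, and the pair \<open>U, V\<close> is
  \<open>h = a + c\<close>.
\<close>

lemma dual_conic:
  assumes x02: "\<not> (x0 = 0 \<and> x2 = 0)"
    and UV: "\<not> (x2 - 2 * a * x1 + a * x0 = 0 \<and> x2 - 2 * x1 + c * x0 = 0)"
  obtains h r where
    "2 * x2 - 2 * (1 + a) * x1 + h * x0 = r * x0"
    "(1 + a) * x2 - 4 * a * x1 + a * (1 + c) * x0 = r * x1"
    "h * x2 - 2 * a * (1 + c) * x1 + 2 * a * c * x0 = r * x2"
    "h \<noteq> a + c" "h \<noteq> 1 + a * c"
proof -
  define r where "r = ((1 + a) * x2 - 4 * a * x1 + a * (1 + c) * x0) / x1"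
  have r2: "(1 + a) * x2 - 4 * a * x1 + a * (1 + c) * x0 = r * x1"
    using x1_nonzero by (simp add: r_def)
  \<comment> \<open>\<open>g\<close> plays the role of \<open>h - r\<close>; it is read off from the
    first row if \<open>x0\<close> is nonzero, otherwise from the third.\<close>
  obtain g where g: "g * x0 = 2 * ((1 + a) * x1 - x2)" "g * x2 = 2 * (a * (1 + c) * x1 - a * c * x0)"
  proof (cases "x0 = 0")
    case False
    show ?thesis
    proof
      show "2 * ((1 + a) * x1 - x2) / x0 * x0 = 2 * ((1 + a) * x1 - x2)"
        using False by simp
      show "2 * ((1 + a) * x1 - x2) / x0 * x2 = 2 * (a * (1 + c) * x1 - a * c * x0)"
      proof -
        have "2 * ((1 + a) * x1 - x2) / x0 * x2 = 2 * (x2 * ((1 + a) * x1 - x2)) / x0"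
          by simp
        then show ?thesis
          using False unfolding consistent by simp
      qed
    qed
  next
    case True
    with x02 have "x2 \<noteq> 0"
      by simp
    with True consistent have "(1 + a) * x1 - x2 = 0"
      by simp
    with True \<open>x2 \<noteq> 0\<close> show ?thesis
      by (intro that[of "2 * (a * (1 + c) * x1 - a * c * x0) / x2"]) simp_all
  qed
  define h where "h = g + r"
  have r1: "2 * x2 - 2 * (1 + a) * x1 + h * x0 = r * x0"
    using g unfolding h_def by algebra
  have r3: "h * x2 - 2 * a * (1 + c) * x1 + 2 * a * c * x0 = r * x2"
    using g unfolding h_def by algebra
  have "h \<noteq> 1 + a * c"
  proof
    assume h: "h = 1 + a * c"
    \<comment> \<open>Here \<open>D\<close> is the symmetrised product of
      \<open>p3 = (1, 1, 1)\<close> and \<open>Q = (1, a, a * c)\<close>, and \<open>p\<close>,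
      \<open>w\<close> are the pairings of \<open>p3\<close>, \<open>Q\<close> with
      \<open>W\<close>.\<close>
    define p where "p = x0 - 2 * x1 + x2"
    define w where "w = x2 - 2 * a * x1 + a * c * x0"
    have 1: "p + w = r * x0" "a * p + w = r * x1" "a * c * p + w = r * x2"
      using r1 r2 r3 unfolding h p_def w_def by (simp_all add: algebra_simps)
    have "2 * (r * (x0 * x2 - x1\<^sup>2)) = 2 * (p * w)"
    proof -
      have "2 * (p * w) = p * (x2 - 2 * a * x1 + a * c * x0) + w * (x0 - 2 * x1 + x2)"
        unfolding p_def[symmetric] w_def[symmetric] by simp
      also have "\<dots> = (p + w) * x2 - 2 * (a * p + w) * x1 + (a * c * p + w) * x0"
        by algebra
      also have "\<dots> = 2 * (r * (x0 * x2 - x1\<^sup>2))"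
        unfolding 1 by algebra
      finally show ?thesis ..
    qed
    then have 2: "r * (x0 * x2 - x1\<^sup>2) = p * w"
      by simp
    \<comment> \<open>\<open>D W = p Q + w p\<^sub>3\<close>, so the homology maps \<open>p\<^sub>3\<close> to \<open>Q\<close>, which is not on the conic.\<close>
    have 3: "p = r * x0 - w" "a * p = r * x1 - w" "a * c * p = r * x2 - w"
      by (simp_all flip: 1)
    \<comment> \<open>Evaluate \<open>x * z - y\<^sup>2\<close> on both sides of
      \<open>p Q = r X - w p3\<close>.\<close>
    have "p\<^sup>2 * (a * (c - a)) = p * (a * c * p) - (a * p) * (a * p)"
      by (simp add: power2_eq_square algebra_simps)
    also have "\<dots> = (r * x0 - w) * (r * x2 - w) - (r * x1 - w) * (r * x1 - w)"
      by (simp only: 3[symmetric])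
    also have "\<dots> = r * (r * (x0 * x2 - x1\<^sup>2)) - r * (p * w)"
      by (simp add: p_def power2_eq_square algebra_simps)
    finally have "p\<^sup>2 * (a * (c - a)) = 0"
      by (simp add: 2)
    then show False
      using x_nonzero a ac by (simp add: p_def)
  qed
  moreover have "h \<noteq> a + c"
  proof
    assume h: "h = a + c"
    \<comment> \<open>Now \<open>D\<close> is the symmetrised product of
      \<open>U = (1, a, a)\<close> and \<open>V = (1, 1, c)\<close>, so
      \<open>D W = u V + v U\<close>.\<close>
    define u where "u = x2 - 2 * a * x1 + a * x0"
    define v where "v = x2 - 2 * x1 + c * x0"
    have 1: "u + v = r * x0" "u + a * v = r * x1" "c * u + a * v = r * x2"
      using r1 r2 r3 unfolding h u_def v_def by (simp_all add: algebra_simps)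
    have "2 * (r * (x0 * x2 - x1\<^sup>2)) = 2 * (u * v)"
    proof -
      have "2 * (u * v) = u * (x2 - 2 * x1 + c * x0) + v * (x2 - 2 * a * x1 + a * x0)"
        unfolding u_def[symmetric] v_def[symmetric] by simp
      also have "\<dots> = (u + v) * x2 - 2 * (u + a * v) * x1 + (c * u + a * v) * x0"
        by algebra
      also have "\<dots> = 2 * (r * (x0 * x2 - x1\<^sup>2))"
        unfolding 1 by algebra
      finally show ?thesis ..
    qed
    then have 2: "r * (x0 * x2 - x1\<^sup>2) = u * v"
      by simp
    have 3: "u = r * x0 - v" "u = r * x1 - a * v" "c * u = r * x2 - a * v"
      by (simp_all flip: 1)
    \<comment> \<open>Evaluating \<open>x * z - y\<^sup>2\<close> on \<open>u V = r X - v U\<close>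
      shows that \<open>u = 0\<close> forces \<open>v = 0\<close>.\<close>
    have "u\<^sup>2 * (c - 1) = u * (c * u) - u * u"
      by (simp add: power2_eq_square algebra_simps)
    also have "\<dots> = (r * x0 - v) * (r * x2 - a * v) - (r * x1 - a * v) * (r * x1 - a * v)"
      by (simp only: 3[symmetric])
    also have "\<dots> = r * (r * (x0 * x2 - x1\<^sup>2)) - r * (u * v) + v\<^sup>2 * (a * (1 - a))"
      by (simp add: u_def power2_eq_square algebra_simps)
    finally have 4: "u\<^sup>2 * (c - 1) = v\<^sup>2 * (a * (1 - a))"
      by (simp add: 2)
    define d where "d = x0 * x2 - x1\<^sup>2"
    \<comment> \<open>If \<open>u, v\<close> were nonzero, the homology would swap \<open>U\<close> and \<open>V\<close>, so the image of \<open>p\<^sub>1p\<^sub>2\<close> would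
      pass through \<open>V\<close> and \<open>p\<^sub>5\<close>, forcing \<open>p\<^sub>6 = p\<^sub>4\<close>, that is, \<open>x1 = 0\<close>.\<close>
    have refl: "(x1 - a * x0) * (c * x1) = d * a - (a * x0 - x1) * x2"
      "(x1 - a * x0) * (x1 + c * x0) = d - (a * x0 - x1) * (2 * x1)"
      "(x1 - a * x0) * x0 = - (a * x0 - x1) * x0"
      by (simp_all add: d_def x_defs power2_eq_square algebra_simps)
    \<comment> \<open>\<open>(c - 1) * x1\<close> is the pairing of \<open>V\<close> with the
      reflected side; \<open>u V\<close> is again replaced by \<open>r X - v U\<close>.\<close>
    have "u * ((c - 1) * x1 * (x1 - a * x0)) = u * ((x1 - a * x0) * (c * x1))
        - u * ((x1 - a * x0) * (x1 + c * x0)) + (c * u) * ((x1 - a * x0) * x0)"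
      by (simp add: algebra_simps)
    also have "\<dots> = (r * x0 - v) * (d * a - (a * x0 - x1) * x2)
        - (r * x1 - a * v) * (d - (a * x0 - x1) * (2 * x1)) + (r * x2 - a * v) * (- (a * x0 - x1) * x0)"
      unfolding refl by (simp only: 3[symmetric])
    also have "\<dots> = (a * x0 - x1) * (u * v - r * (x0 * x2 - x1\<^sup>2))"
      by (simp add: d_def u_def power2_eq_square algebra_simps)
    finally have "u * ((c - 1) * x1 * (x1 - a * x0)) = 0"
      by (simp add: 2)
    then have "u = 0"
      using c x1_nonzero x_nonzero by auto
    then have "v = 0"
      using 4 a by auto
    with UV \<open>u = 0\<close> show False
      by (simp add: u_def v_def)
  qed
  ultimately show ?thesis
    using that r1 r2 r3 by blast
qed

lemma octagon:
  fixes n k1 k2 k3 k4 k5 k7 :: 'k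
  defines "p1 \<equiv> k1 *s conic_point 1 a" and "p2 \<equiv> k2 *s conic_point 0 1"
    and "p3 \<equiv> k3 *s conic_point 1 1" and "p4 \<equiv> k4 *s conic_point 1 0"
    and "p5 \<equiv> k5 *s conic_point 1 c" and "p7 \<equiv> k7 *s conic_point 1 s"
  assumes n: "n \<noteq> 0" and k: "k1 \<noteq> 0" "k2 \<noteq> 0" "k3 \<noteq> 0" "k4 \<noteq> 0" "k5 \<noteq> 0" "k7 \<noteq> 0"
    and nd: "nondegenerate_seventh (std_conic n) p1 p2 p3 p4 p5 p7"
  shows "\<exists>p6 p8. on_conic (std_conic n) p6 \<and> on_conic (std_conic n) p8 \<and>
    poncelet_octagon (std_conic n) [p1, p2, p3, p4, p5, p6, p7, p8]"
proof -
  define X :: "'k ^ 3" where "X = vector [x0, x1, x2]"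
  define U :: "'k ^ 3" where "U = vector [1, a, a]"
  define V :: "'k ^ 3" where "V = vector [1, 1, c]"
  define W :: "'k ^ 3" where "W = vector [x2, - 2 * x1, x0]"
  have meetI: "is_meet Y p q p' q'"
    if "is_join l p q" "is_join m p' q'" "incident l Y" "incident m Y" "Y \<noteq> 0"
      "l $ i * m $ j \<noteq> l $ j * m $ i" for Y p q p' q' l m :: "'k ^ 3" and i j
    unfolding is_meet_def using that proj_eq_minor by blast
  have "is_meet X p1 p5 p3 p7"
    unfolding p1_def p5_def p3_def p7_def
  proof (rule meetI[OF is_join_chord is_join_chord, where i = 1 and j = 3])
    show "chord 1 a 1 c $ 1 * chord 1 1 1 s $ 3 \<noteq> chord 1 a 1 c $ 3 * chord 1 1 1 s $ 1"
      using x1_nonzero by (simp add: chord_def x1_def)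
  qed (use k ac s1 x1_nonzero in \<open>simp_all add: X_def incident_3 chord_def vector_eq_0_iff\<close>,
    simp_all add: x_defs algebra_simps)
  moreover have "is_meet U p1 p2 p3 p4"
    unfolding p1_def p2_def p3_def p4_def
    by (rule meetI[OF is_join_chord is_join_chord, where i = 1 and j = 3])
      (use k a in \<open>simp_all add: U_def incident_3 chord_def vector_eq_0_iff\<close>)
  moreover have "is_meet V p2 p3 p4 p5"
    unfolding p2_def p3_def p4_def p5_def
    by (rule meetI[OF is_join_chord is_join_chord, where i = 1 and j = 3])
      (use k c in \<open>simp_all add: V_def incident_3 chord_def vector_eq_0_iff\<close>)
  ultimately have "\<not> (conjugate_wrt (std_conic n) X p2 \<and> conjugate_wrt (std_conic n) X p4)"
    "\<not> (conjugate_wrt (std_conic n) X U \<and> conjugate_wrt (std_conic n) X V)"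
    using nd unfolding nondegenerate_seventh_def by blast+
  then have "\<not> (x0 = 0 \<and> x2 = 0)"
    "\<not> (x2 - 2 * a * x1 + a * x0 = 0 \<and> x2 - 2 * x1 + c * x0 = 0)"
    using n k by (simp_all add: conjugate_wrt_std_conic p2_def p4_def X_def U_def V_def
        conic_point_def algebra_simps)
  then obtain h r where rows:
      "2 * x2 - 2 * (1 + a) * x1 + h * x0 = r * x0"
      "(1 + a) * x2 - 4 * a * x1 + a * (1 + c) * x0 = r * x1"
      "h * x2 - 2 * a * (1 + c) * x1 + 2 * a * c * x0 = r * x2"
    and h: "h \<noteq> a + c" "h \<noteq> 1 + a * c"
    by (rule dual_conic)
  define D :: "'k ^ 3 ^ 3" where
    "D = vector [vector [2, 1 + a, h], vector [1 + a, 2 * a, a * (1 + c)],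
      vector [h, a * (1 + c), 2 * a * c]]"
  \<comment> \<open>The roots in \<open>h\<close> are exactly the two point pairs
    \<open>U, V\<close> and \<open>p3, Q\<close>.\<close>
  have "det D = - 2 * a * (h - (a + c)) * (h - (1 + a * c))"
    by (simp add: det_3 D_def algebra_simps)
  then have "invertible D"
    using a h by (simp add: invertible_det_nz)
  then obtain B where B: "D ** B = mat 1" "B ** D = mat 1"
    by (auto simp: invertible_def)
  have D_sym: "transpose D = D"
    by (simp add: D_def transpose_def vec_eq_iff forall_3)
  have D_pairing: "pairing l (D *v l) = 2 * ((l$1)\<^sup>2 + (1 + a) * l$1 * l$2 + h * l$1 * l$3 +
      a * (l$2)\<^sup>2 + a * (1 + c) * l$2 * l$3 + a * c * (l$3)\<^sup>2)" for l
    by (simp add: D_def pairing_3 matrix_vector_mult_def sum_3 power2_eq_square algebra_simps)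
  have DW: "D *v W = r *s X"
    using rows by (simp add: D_def W_def X_def matrix_vector_mult_def sum_3 vec_eq_iff forall_3 algebra_simps)
  have "nondegenerate_conic B"
  proof -
    have "det B * det D = 1"
      using B by (metis det_I det_mul)
    then have "det B \<noteq> 0"
      by auto
    moreover from this have "B \<noteq> 0"
      by (metis det_0 mat_0)
    moreover have "transpose B = B"
    proof -
      have "transpose B ** D = mat 1"
        by (metis B(1) D_sym matrix_transpose_mul transpose_mat)
      then show ?thesis
        by (metis B(1) matrix_mul_assoc matrix_mul_lid matrix_mul_rid)
    qed
    ultimately show ?thesis
      by (simp add: nondegenerate_conic_def is_conic_def)
  qed
  \<comment> \<open>Homogeneous parameters of the eight vertices. \<open>(x0, x1)\<close> and
    \<open>(x1, x2)\<close> are the second intersections of the conic with the lines joining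
    \<open>X\<close> to \<open>p2\<close> and \<open>p4\<close>.\<close>
  define xs where "xs = [1, 0, 1, 1, 1, x0, 1, x1]"
  define ys where "ys = [a, 1, 1, 0, c, x1, s, x2]"
  define u where "u i = conic_point (xs ! i) (ys ! i)" for i
  define m where "m i = chord (xs ! i) (ys ! i) (xs ! (Suc i mod 8)) (ys ! (Suc i mod 8))" for i
  have less_8: "i < 8 \<longleftrightarrow> i \<in> {0, 1, 2, 3, 4, 5, 6, 7}" for i :: nat
    by auto
  have XW: "pairing X W = 2 * (x0 * x2 - x1\<^sup>2)"
    by (simp add: X_def W_def pairing_3 power2_eq_square)
  have nonzero: "xs ! i \<noteq> 0 \<or> ys ! i \<noteq> 0" if "i < 8" for i
    using that x1_nonzero unfolding less_8 by (auto simp: xs_def ys_def)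
  have step1: "xs ! (Suc i mod 8) * ys ! i \<noteq> xs ! i * ys ! (Suc i mod 8)" if "i < 8" for i
    using that c x_nonzero unfolding less_8 by (auto simp: xs_def ys_def mult.commute)
  \<comment> \<open>Vertices two steps apart differ, which makes consecutive sides distinct.\<close>
  have step2: "xs ! i * ys ! (Suc (Suc i mod 8) mod 8) \<noteq> xs ! (Suc (Suc i mod 8) mod 8) * ys ! i"
    if "i < 8" for i
    using that a c s_neq x1_nonzero x_nonzero unfolding less_8
    by (auto simp: xs_def ys_def mult.commute power2_eq_square)
  \<comment> \<open>These sides pass through \<open>p2\<close> or \<open>p4\<close>, so their third
    or first coordinate is zero and the term with \<open>h\<close> vanishes.\<close>
  have first_half: "pairing (m i) (D *v m i) = 0" if "i \<in> {0, 1, 2, 3}" for i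
    using that unfolding D_pairing
    by (auto simp: m_def xs_def ys_def chord_def power2_eq_square algebra_simps)
  \<comment> \<open>The homology swaps vertices \<open>i\<close> and \<open>i + 4\<close>, hence
    also the sides with these indices.\<close>
  have reflected: "\<exists>k. k \<noteq> 0 \<and> k *s m (i + 4) = pairing X W *s m i - (2 * pairing (m i) X) *s W"
    if "i \<in> {0, 1, 2, 3}" for i
  proof -
    have ne: "x1 - a * x0 \<noteq> 0" "x0 - x1 \<noteq> 0" "c * x0 - x1 \<noteq> 0"
    proof -
      have "x0 - x1 = (1 - a) * (1 - c)"
        by (simp add: x_defs algebra_simps)
      then show "x0 - x1 \<noteq> 0"
        using a c by simp
    qed (use x_nonzero in auto)
    have m: "m 0 = vector [a, - 1, 0]" "m 1 = vector [1, - 1, 0]"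
      "m 2 = vector [0, - 1, 1]" "m 3 = vector [0, - c, 1]"
      "m 4 = vector [c * x1, - (x1 + x0 * c), x0]" "m 5 = vector [x1 * s, - (x0 * s + x1), x0]"
      "m 6 = vector [s * x2, - (x2 + x1 * s), x1]" "m 7 = vector [x2 * a, - (x1 * a + x2), x1]"
      by (simp_all add: m_def xs_def ys_def chord_def)
    have 0: "(2 * (x1 - a * x0)) *s m 4 = pairing X W *s m 0 - (2 * pairing (m 0) X) *s W"
      unfolding XW m W_def X_def pairing_3 vec_eq_iff forall_3 x_defs
      by (simp add: power2_eq_square algebra_simps)
    have 1: "(2 * (x1 - x0)) *s m 5 = pairing X W *s m 1 - (2 * pairing (m 1) X) *s W"
      unfolding XW m W_def X_def pairing_3 vec_eq_iff forall_3 x_defs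
      by (simp add: power2_eq_square algebra_simps)
    have 2: "(2 * (x0 - x1)) *s m 6 = pairing X W *s m 2 - (2 * pairing (m 2) X) *s W"
      unfolding XW m W_def X_def pairing_3 vec_eq_iff forall_3 x_defs
      by (simp add: power2_eq_square algebra_simps)
    have 3: "(2 * (c * x0 - x1)) *s m 7 = pairing X W *s m 3 - (2 * pairing (m 3) X) *s W"
      unfolding XW m W_def X_def pairing_3 vec_eq_iff forall_3 x_defs
      by (simp add: power2_eq_square algebra_simps)
    have "2 * (x1 - a * x0) \<noteq> 0" "2 * (x1 - x0) \<noteq> 0" "2 * (x0 - x1) \<noteq> 0" "2 * (c * x0 - x1) \<noteq> 0"
      using ne by auto
    with 0 1 2 3 have "\<exists>k. k \<noteq> 0 \<and> k *s m 4 = pairing X W *s m 0 - (2 * pairing (m 0) X) *s W"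
      "\<exists>k. k \<noteq> 0 \<and> k *s m 5 = pairing X W *s m 1 - (2 * pairing (m 1) X) *s W"
      "\<exists>k. k \<noteq> 0 \<and> k *s m 6 = pairing X W *s m 2 - (2 * pairing (m 2) X) *s W"
      "\<exists>k. k \<noteq> 0 \<and> k *s m 7 = pairing X W *s m 3 - (2 * pairing (m 3) X) *s W"
      by blast+
    then show ?thesis
      using that by auto
  qed
  have tangent: "tangent B (m i)" if "i < 8" for i
  proof (rule tangent_if_dual_conic[OF B(2)])
    show "m i \<noteq> 0"
      unfolding m_def using step1[OF that] by (intro chord_nonzero) metis
    show "pairing (m i) (D *v m i) = 0"
    proof (cases "i < 4")
      case True
      then have "i \<in> {0, 1, 2, 3}"
        by auto
      then show ?thesis
        by (rule first_half)
    next
      case False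
      then obtain j where j: "i = j + 4" "j \<in> {0, 1, 2, 3}"
        using \<open>i < 8\<close> by (intro that[of "i - 4"]) auto
      then show ?thesis
        using reflected[OF j(2)] reflection_dual_conic[OF D_sym DW first_half[OF j(2)]] by auto
    qed
  qed
  have "poncelet_octagon (std_conic n) [p1, p2, p3, p4, p5, u 5, p7, u 7]"
  proof (rule poncelet_octagonI[of _ B _ u m])
    show "\<not> proj_eq (u (Suc i mod 8)) (u i)" if "i < 8" for i
      unfolding u_def using step1[OF that] by (rule not_proj_eq_conic_point)
    show "\<not> proj_eq (m (Suc i mod 8)) (m i)" if "i < 8" for i
      unfolding m_def using nonzero step2[OF that] by (intro not_proj_eq_chord) simp_all
    show "proj_eq (u i) ([p1, p2, p3, p4, p5, u 5, p7, u 7] ! i)" if "i < 8" for i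
      using that k proj_eq_smult proj_eq_smult[of 1 "u i"] unfolding less_8
      by (auto simp: u_def xs_def ys_def p1_def p2_def p3_def p4_def p5_def p7_def)
  qed (use n \<open>nondegenerate_conic B\<close> tangent nonzero in
      \<open>simp_all add: nondegenerate_std_conic on_std_conic_point u_def m_def incident_chord\<close>)
  moreover have "on_conic (std_conic n) (u 5)" "on_conic (std_conic n) (u 7)"
    using nonzero n by (simp_all add: u_def on_std_conic_point)
  ultimately show ?thesis
    by blast
qed

end

subsection \<open>Reduction to standard position\<close>

lemma collinear3_iff_det: "collinear3 x y z \<longleftrightarrow> det (vector [x, y, z] :: 'k::field ^ 3 ^ 3) = 0"
proof -
  have "(vector [x, y, z] :: 'k ^ 3 ^ 3) *v l = 0 \<longleftrightarrow> incident l x \<and> incident l y \<and> incident l z" for l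
    unfolding vec_eq_iff forall_3
    by (simp add: matrix_vector_mult_def sum_3 incident_3 mult.commute)
  then show ?thesis
    unfolding collinear3_def
    by (metis invertible_det_nz invertible_left_inverse matrix_left_invertible_ker)
qed

lemma no_three_collinear_nth:
  assumes "no_three_collinear [x1, x2, x3, x4, x5]" and "i < j" "j < k" "k < 5"
  shows "\<not> collinear3 ([x1, x2, x3, x4, x5] ! i) ([x1, x2, x3, x4, x5] ! j) ([x1, x2, x3, x4, x5] ! k)"
  using assms by (simp add: no_three_collinear_def)

lemma is_meet_collinear3:
  assumes "is_meet X a b c d"
  shows "X \<noteq> 0" "collinear3 a b X" "collinear3 c d X"
  using assms unfolding is_meet_def is_join_def collinear3_def by blast+

section \<open>Nondegeneracy of a conic through five points in general position\<close>

lemma pairing_conic_commute: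
  assumes "transpose C = C"
  shows "pairing x (C *v y) = pairing y (C *v (x :: 'k::field ^ 3))"
  using pairing_matrix_vector_mult[of C y x] assms by (simp add: pairing_3 mult.commute)

text \<open>Conjugate points \<open>x\<close>, \<open>y\<close> of the conic span a line contained
  in it. If \<open>u\<close>, \<open>v\<close> are distinct, the line joining them meets that line
  in a third zero of the form, which forces the mixed term to vanish.\<close>

lemma pairing_conic_zero_off_secant:
  fixes C :: "'k::field_char_0 ^ 3 ^ 3"
  assumes C: "transpose C = C" "on_conic C x" "on_conic C y" "on_conic C u" "on_conic C v"
    and xy: "pairing x (C *v y) = 0"
    and "\<not> collinear3 x y u" "\<not> collinear3 x y v"
  shows "pairing u (C *v v) = 0"
proof -
  define d where "d u v w = det (vector [u, v, w] :: 'k ^ 3 ^ 3)" for u v w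
  define f where "f u v = pairing u (C *v v)" for u v
  \<comment> \<open>The common point of the lines \<open>x y\<close> and \<open>u v\<close>; the
    next identity rewrites it in terms of \<open>x\<close> and \<open>y\<close>.\<close>
  define z where "z = d x y v *s u - d x y u *s v"
  have z: "z = d x u v *s y - d y u v *s x"
    by (simp add: z_def d_def det_3 vec_eq_iff forall_3 algebra_simps)
  have f_diff: "f (p *s u - q *s v) (p *s u - q *s v)
      = p\<^sup>2 * f u u - 2 * p * q * f u v + q\<^sup>2 * f v v" for p q u v
  proof -
    have "f (p *s u - q *s v) (p *s u - q *s v) = p\<^sup>2 * f u u - p * q * f u v - p * q * f v u + q\<^sup>2 * f v v"
      by (simp add: f_def pairing_3 matrix_vector_mult_def sum_3 power2_eq_square algebra_simps)
    also have "f v u = f u v"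
      unfolding f_def by (rule pairing_conic_commute[OF C(1)])
    finally show ?thesis
      by (simp add: algebra_simps)
  qed
  have f0: "f x x = 0" "f y y = 0" "f u u = 0" "f v v = 0" "f y x = 0"
    using C xy pairing_conic_commute[OF C(1), of y x] by (simp_all add: f_def on_conic_def conjugate_wrt_def)
  have "f z z = - 2 * d x y v * d x y u * f u v"
    unfolding z_def f_diff by (simp add: f0)
  moreover have "f z z = 0"
    unfolding z f_diff by (simp add: f0)
  ultimately show ?thesis
    using assms(7,8) by (simp add: f_def d_def collinear3_iff_det)
qed

text \<open>Otherwise the form vanishes on all pairs from the basis \<open>u\<close>,
  \<open>v\<close>, \<open>w\<close>, and \<open>C\<close> would be zero.\<close>

lemma pairing_conic_nonzero:
  fixes C :: "'k::field_char_0 ^ 3 ^ 3"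
  assumes C: "is_conic C" "on_conic C x" "on_conic C y" "on_conic C u" "on_conic C v" "on_conic C w"
    and secant: "\<not> collinear3 x y u" "\<not> collinear3 x y v" "\<not> collinear3 x y w"
    and basis: "\<not> collinear3 u v w"
  shows "pairing x (C *v y) \<noteq> 0"
proof
  assume xy: "pairing x (C *v y) = 0"
  have sym: "transpose C = C" and "C \<noteq> 0"
    using C(1) by (simp_all add: is_conic_def)
  have "pairing p (C *v q) = 0" if "p \<in> {u, v, w}" "q \<in> {u, v, w}" for p q
    by (rule pairing_conic_zero_off_secant[OF sym C(2,3) _ _ xy]) (use that C secant in auto)
  then have *: "incident (C *v p) q" if "p \<in> {u, v, w}" "q \<in> {u, v, w}" for p q
    using that by (simp add: incident_def pairing_def mult.commute)
  have Cu: "C *v p = 0" if "p \<in> {u, v, w}" for p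
    using *[OF that] basis unfolding collinear3_def by blast
  have "C $ i = 0" for i
  proof -
    have "incident (C $ i) p" if "p \<in> {u, v, w}" for p
      using Cu[OF that] by (simp add: incident_3 vec_eq_iff matrix_vector_mult_def sum_3)
    then show ?thesis
      using basis unfolding collinear3_def by blast
  qed
  with \<open>C \<noteq> 0\<close> show False
    by (simp add: vec_eq_iff)
qed

lemma std_coordinates:
  fixes C :: "'k::field_char_0 ^ 3 ^ 3"
  assumes C: "transpose C = C" "on_conic C p2" "on_conic C p3" "on_conic C p4"
    and nz: "pairing p2 (C *v p4) \<noteq> 0" "pairing p2 (C *v p3) \<noteq> 0" "pairing p3 (C *v p4) \<noteq> 0"
    and general: "\<not> collinear3 p2 p3 p4"
  obtains M N n k2 k4 where "coordinate_change M N" "n \<noteq> 0" "transpose M ** C ** M = std_conic n"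
    "k2 \<noteq> 0" "k4 \<noteq> 0" "N *v p2 = k2 *s conic_point 0 1" "N *v p3 = conic_point 1 1"
    "N *v p4 = k4 *s conic_point 1 0"
proof -
  define f where "f u v = pairing u (C *v v)" for u v
  \<comment> \<open>The scalars make \<open>b2\<close> conjugate to \<open>p2\<close> and
    \<open>p4\<close>, so it represents the pole of their line, while \<open>p3\<close> becomes the
    unit point.\<close>
  define \<alpha> where "\<alpha> = f p2 p3 / f p2 p4"
  define \<gamma> where "\<gamma> = f p3 p4 / f p2 p4"
  define b1 where "b1 = \<alpha> *s p4"
  define b3 where "b3 = \<gamma> *s p2"
  define b2 where "b2 = p3 - b1 - b3"
  define M :: "'k ^ 3 ^ 3" where "M = transpose (vector [b1, b2, b3])"
  define n where "n = \<alpha> * \<gamma> * f p2 p4"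
  have "f p2 p4 \<noteq> 0" "\<alpha> \<noteq> 0" "\<gamma> \<noteq> 0"
    using nz by (simp_all add: f_def \<alpha>_def \<gamma>_def)
  have M_apply: "M *v x = x$1 *s b1 + x$2 *s b2 + x$3 *s b3" for x
    by (simp add: M_def vec_eq_iff forall_3 matrix_vector_mult_def sum_3 transpose_def algebra_simps)
  have "det M = - \<alpha> * \<gamma> * det (vector [p2, p3, p4] :: 'k ^ 3 ^ 3)"
    by (simp add: M_def) (simp add: det_3 b1_def b2_def b3_def algebra_simps)
  then have "invertible M"
    using general \<open>\<alpha> \<noteq> 0\<close> \<open>\<gamma> \<noteq> 0\<close> by (simp add: invertible_det_nz collinear3_iff_det)
  then obtain N where N: "M ** N = mat 1" "N ** M = mat 1"
    by (auto simp: invertible_def)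
  interpret coordinate_change M N
    by unfold_locales fact+
  have f_sym: "f u v = f v u" for u v
    unfolding f_def by (rule pairing_conic_commute[OF C(1)])
  have f_linear: "f (u - v) w = f u w - f v w" "f (r *s u) w = r * f u w"
    "f w (u - v) = f w u - f w v" "f w (r *s u) = r * f w u" for u v w r
    by (simp_all add: f_def pairing_3 matrix_vector_mult_def sum_3 algebra_simps)
  have f0: "f p2 p2 = 0" "f p3 p3 = 0" "f p4 p4 = 0"
    using C by (simp_all add: f_def on_conic_def conjugate_wrt_def)
  have f_eqs: "f p2 p3 = \<alpha> * f p2 p4" "f p3 p2 = \<alpha> * f p2 p4" "f p3 p4 = \<gamma> * f p2 p4"
    "f p4 p3 = \<gamma> * f p2 p4" "f p4 p2 = f p2 p4"
    using \<open>f p2 p4 \<noteq> 0\<close> f_sym[of p3 p2] f_sym[of p4 p3] f_sym[of p4 p2]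
    by (simp_all add: \<alpha>_def \<gamma>_def)
  have "transpose M ** C ** M = vector [vector [f b1 b1, f b1 b2, f b1 b3],
      vector [f b2 b1, f b2 b2, f b2 b3], vector [f b3 b1, f b3 b2, f b3 b3]]"
    by (simp add: M_def f_def vec_eq_iff forall_3 matrix_matrix_mult_def matrix_vector_mult_def
        transpose_def sum_3 pairing_3 algebra_simps)
  also have "\<dots> = std_conic n"
    unfolding b1_def b2_def b3_def f_linear f0 f_eqs std_conic_def n_def
    by (simp add: algebra_simps)
  finally have "transpose M ** C ** M = std_conic n" .
  moreover have "M *v ((1 / \<gamma>) *s conic_point 0 1) = p2" "M *v conic_point 1 1 = p3"
    "M *v ((1 / \<alpha>) *s conic_point 1 0) = p4"
    using \<open>\<alpha> \<noteq> 0\<close> \<open>\<gamma> \<noteq> 0\<close>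
    by (simp_all add: M_apply conic_point_def b1_def b3_def b2_def vec_eq_iff)
  then have "N *v p2 = (1 / \<gamma>) *s conic_point 0 1" "N *v p3 = conic_point 1 1"
    "N *v p4 = (1 / \<alpha>) *s conic_point 1 0"
    by (metis M_N(2))+
  moreover have "n \<noteq> 0"
    using \<open>f p2 p4 \<noteq> 0\<close> \<open>\<alpha> \<noteq> 0\<close> \<open>\<gamma> \<noteq> 0\<close> by (simp add: n_def)
  ultimately show ?thesis
    using that[of M N n "1 / \<gamma>" "1 / \<alpha>"] \<open>\<alpha> \<noteq> 0\<close> \<open>\<gamma> \<noteq> 0\<close> coordinate_change_axioms by simp
qed

section \<open>The construction of the seventh point in coordinates\<close>

lemma on_std_conic_cases:
  assumes "on_conic (std_conic n) (q :: 'k::field_char_0 ^ 3)" "n \<noteq> 0"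
  obtains "q$1 = 0" "q$2 = 0" | k t where "k \<noteq> 0" "q = k *s conic_point 1 t"
proof (cases "q$1 = 0")
  case True
  then show ?thesis
    using assms that(1) by (auto simp: on_conic_def conjugate_wrt_std_conic)
next
  case False
  have "2 * (q$1 * q$3) = 2 * (q$2 * q$2)"
    using assms by (simp add: on_conic_def conjugate_wrt_std_conic algebra_simps)
  then have "q$1 * q$3 = q$2 * q$2"
    by simp
  then have "q = q$1 *s conic_point 1 (q$2 / q$1)"
    using False by (simp add: conic_point_def vec_eq_iff forall_3 power2_eq_square field_simps)
  with False show ?thesis
    by (rule that(2))
qed

lemma seventh_point_std_conic:
  fixes n k2 k4 :: "'k::field_char_0"
  defines "p2 \<equiv> k2 *s conic_point 0 1" and "p3 \<equiv> conic_point 1 1" and "p4 \<equiv> k4 *s conic_point 1 0"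
  assumes n: "n \<noteq> 0" and k: "k2 \<noteq> 0" "k4 \<noteq> 0"
    and general: "no_three_collinear [p1, p2, p3, p4, p5]"
    and conic: "on_conic (std_conic n) p1" "on_conic (std_conic n) p5"
    and P: "is_meet P p1 p4 p2 p5"
    and Q: "is_meet Q p1 p2 p4 p5"
    and R: "is_meet R p2 p4 p3 Q"
    and l: "is_join l R P"
    and p7: "incident l p7" "on_conic (std_conic n) p7"
    and nondegenerate: "nondegenerate_seventh (std_conic n) p1 p2 p3 p4 p5 p7"
  shows "\<exists>p6 p8. on_conic (std_conic n) p6 \<and> on_conic (std_conic n) p8 \<and>
    poncelet_octagon (std_conic n) [p1, p2, p3, p4, p5, p6, p7, p8]"
proof -
  have not_collinear: "\<not> collinear3 p1 p2 p3" "\<not> collinear3 p1 p2 p4" "\<not> collinear3 p1 p2 p5"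
    "\<not> collinear3 p2 p3 p5" "\<not> collinear3 p2 p4 p5"
    using no_three_collinear_nth[OF general, of 0 1 2] no_three_collinear_nth[OF general, of 0 1 3]
      no_three_collinear_nth[OF general, of 0 1 4] no_three_collinear_nth[OF general, of 1 2 4]
      no_three_collinear_nth[OF general, of 1 3 4] by simp_all
  note expand = collinear3_iff_det det_3 conic_point_def p2_def p3_def p4_def
  obtain k1 a where k1: "k1 \<noteq> 0" and p1: "p1 = k1 *s conic_point 1 a"
    using conic(1) n
  proof (cases rule: on_std_conic_cases)
    case 1
    with not_collinear(1) show ?thesis
      by (simp add: expand)
  qed
  obtain k5 c where k5: "k5 \<noteq> 0" and p5: "p5 = k5 *s conic_point 1 c"
    using conic(2) n
  proof (cases rule: on_std_conic_cases)
    case 1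
    with not_collinear(3) show ?thesis
      by (simp add: expand)
  qed
  have a: "a \<noteq> 0" "a \<noteq> 1" and c: "c \<noteq> 0" "c \<noteq> 1" and ac: "a \<noteq> c"
    using not_collinear by (auto simp: expand p1 p5)
  have P_eq: "P$2 = c * P$1" "P$3 = a * P$2" "P$1 \<noteq> 0"
    using is_meet_collinear3[OF P] k k1 k5 a c
    by (auto simp: expand p1 p5 vector_eq_0_iff power2_eq_square)
  have Q_eq: "Q$2 = a * Q$1" "Q$3 = c * Q$2" "Q$1 \<noteq> 0"
    using is_meet_collinear3[OF Q] k k1 k5 a c
    by (auto simp: expand p1 p5 vector_eq_0_iff power2_eq_square)
  have "k2 * k4 * R$2 = 0"
    using is_meet_collinear3(2)[OF R] by (simp add: expand)
  then have R2: "R$2 = 0"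
    using k by simp
  have "Q$1 * (R$1 * (a * (c - 1)) - R$3 * (1 - a)) = 0"
    using is_meet_collinear3(3)[OF R] by (simp add: expand R2 Q_eq algebra_simps)
  then have R3: "R$1 * (a * (c - 1)) = R$3 * (1 - a)"
    using Q_eq by simp
  have R1: "R$1 \<noteq> 0"
    using is_meet_collinear3(1)[OF R] R2 R3 a by (auto simp: vector_eq_0_iff)
  have "collinear3 R P p7"
    using l p7 unfolding is_join_def collinear3_def by blast
  then have "P$1 * (R$1 * (c * p7$3 - a * c * p7$2) + R$3 * (p7$2 - c * p7$1)) = 0"
    by (simp add: expand R2 P_eq algebra_simps)
  then have "R$1 * (c * p7$3 - a * c * p7$2) + R$3 * (p7$2 - c * p7$1) = 0"
    using P_eq by simp
  then have "(1 - a) * R$1 * (c * p7$3 - a * c * p7$2) + (R$3 * (1 - a)) * (p7$2 - c * p7$1) = 0"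
    by algebra
  then have "R$1 * ((1 - a) * (c * p7$3 - a * c * p7$2) + a * (c - 1) * (p7$2 - c * p7$1)) = 0"
    unfolding R3[symmetric] by (simp add: algebra_simps)
  \<comment> \<open>The equation of \<open>l\<close> at \<open>p7\<close> once \<open>P\<close>,
    \<open>Q\<close> and \<open>R\<close> are eliminated; on the conic it becomes the quadratic for
    \<open>s\<close>.\<close>
  then have seventh: "(1 - a) * (c * p7$3 - a * c * p7$2) + a * (c - 1) * (p7$2 - c * p7$1) = 0"
    using R1 by simp
  obtain k7 s where k7: "k7 \<noteq> 0" and p7_eq: "p7 = k7 *s conic_point 1 s"
    using p7(2) n
  proof (cases rule: on_std_conic_cases)
    case 1
    \<comment> \<open>The line \<open>l\<close> misses \<open>p2\<close>: with two zero coordinates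
      the equation leaves \<open>(1 - a) * c * p7$3 = 0\<close>.\<close>
    with seventh a c have "p7 = 0"
      by (auto simp: vector_eq_0_iff)
    with p7(2) show ?thesis
      by (simp add: on_conic_def)
  qed
  have "k7 * (c * (1 - a) * s\<^sup>2 - a * (1 - a * c) * s + a * c * (1 - c)) = 0"
    using seventh by (simp add: p7_eq conic_point_def power2_eq_square algebra_simps)
  then have "c * (1 - a) * s\<^sup>2 - a * (1 - a * c) * s + a * c * (1 - c) = 0"
    using k7 by simp
  moreover have "s \<noteq> 1"
  proof
    assume "s = 1"
    then have "proj_eq p3 p7"
      using proj_eq_smult[OF k7] by (simp add: p3_def p7_eq)
    then show False
      using nondegenerate by (simp add: nondegenerate_seventh_def)
  qed
  ultimately interpret seventh_point a c s
    using a c ac by unfold_locales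
  show ?thesis
    using octagon[OF n k1 k(1) _ k(2) k5 k7, of 1] nondegenerate
    by (simp add: p1 p2_def p3_def p4_def p5 p7_eq)
qed

theorem theorem5:
  fixes p1 p2 p3 p4 p5 p7 P Q R l :: "'k::{real_normed_field, euclidean_space} ^ 3"
    and C :: "'k ^ 3 ^ 3"
  assumes points: "p1 \<noteq> 0" "p2 \<noteq> 0" "p3 \<noteq> 0" "p4 \<noteq> 0" "p5 \<noteq> 0"
    and general: "no_three_collinear [p1, p2, p3, p4, p5]"
    and conic: "is_conic C" "on_conic C p1" "on_conic C p2" "on_conic C p3" "on_conic C p4"
      "on_conic C p5"
    and P: "is_meet P p1 p4 p2 p5"
    and Q: "is_meet Q p1 p2 p4 p5"
    and R: "is_meet R p2 p4 p3 Q"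
    and l: "is_join l R P"
    and p7: "incident l p7" "on_conic C p7"
    and nondegenerate: "nondegenerate_seventh C p1 p2 p3 p4 p5 p7"
  shows "\<exists>p6 p8. on_conic C p6 \<and> on_conic C p8 \<and>
    poncelet_octagon C [p1, p2, p3, p4, p5, p6, p7, p8]"
proof -
  have collinear3_perm: "collinear3 x y z \<longleftrightarrow> collinear3 y x z" "collinear3 x y z \<longleftrightarrow> collinear3 x z y"
    for x y z :: "'k ^ 3"
    unfolding collinear3_def by blast+
  have triples: "\<not> collinear3 p1 p2 p3" "\<not> collinear3 p1 p2 p4" "\<not> collinear3 p1 p2 p5"
    "\<not> collinear3 p1 p3 p4" "\<not> collinear3 p1 p3 p5" "\<not> collinear3 p1 p4 p5"
    "\<not> collinear3 p2 p3 p4" "\<not> collinear3 p2 p3 p5" "\<not> collinear3 p2 p4 p5" "\<not> collinear3 p3 p4 p5"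
    using no_three_collinear_nth[OF general, of 0 1 2] no_three_collinear_nth[OF general, of 0 1 3]
      no_three_collinear_nth[OF general, of 0 1 4] no_three_collinear_nth[OF general, of 0 2 3]
      no_three_collinear_nth[OF general, of 0 2 4] no_three_collinear_nth[OF general, of 0 3 4]
      no_three_collinear_nth[OF general, of 1 2 3] no_three_collinear_nth[OF general, of 1 2 4]
      no_three_collinear_nth[OF general, of 1 3 4] no_three_collinear_nth[OF general, of 2 3 4]
    by simp_all
  have "transpose C = C"
    using conic(1) by (simp add: is_conic_def)
  \<comment> \<open>For each pair the other three given points serve as the basis off the
    secant.\<close>
  moreover have "pairing p2 (C *v p4) \<noteq> 0"
    by (rule pairing_conic_nonzero[OF conic(1,3,5,2,4,6)]) (use triples collinear3_perm in blast)+
  moreover have "pairing p2 (C *v p3) \<noteq> 0"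
    by (rule pairing_conic_nonzero[OF conic(1,3,4,2,5,6)]) (use triples collinear3_perm in blast)+
  moreover have "pairing p3 (C *v p4) \<noteq> 0"
    by (rule pairing_conic_nonzero[OF conic(1,4,5,2,3,6)]) (use triples collinear3_perm in blast)+
  ultimately obtain M N n k2 k4 where change: "coordinate_change M N" and n: "n \<noteq> 0"
    and C: "transpose M ** C ** M = std_conic n" and k: "k2 \<noteq> 0" "k4 \<noteq> 0"
    and N: "N *v p2 = k2 *s conic_point 0 1" "N *v p3 = conic_point 1 1" "N *v p4 = k4 *s conic_point 1 0"
    using conic(3,4,5) triples(7) by (elim std_coordinates)
  interpret coordinate_change M N
    by (rule change)
  interpret inv: coordinate_change N M
    by (rule inverse)
  have "\<exists>q6 q8. on_conic (std_conic n) q6 \<and> on_conic (std_conic n) q8 \<and>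
    poncelet_octagon (std_conic n) [N *v p1, N *v p2, N *v p3, N *v p4, N *v p5, q6, N *v p7, q8]"
  proof (rule seventh_point_std_conic[OF n k, folded N])
    show "no_three_collinear [N *v p1, N *v p2, N *v p3, N *v p4, N *v p5]"
      using general inv.no_three_collinear_point[of "[p1, p2, p3, p4, p5]"] by simp
    show "is_meet (N *v Q) (N *v p1) (N *v p2) (N *v p4) (N *v p5)"
      "is_meet (N *v R) (N *v p2) (N *v p4) (N *v p3) (N *v Q)"
      using Q R by simp_all
    show "is_join (transpose M *v l) (N *v R) (N *v P)"
      using l by (simp del: transpose_matrix_vector)
    show "incident (transpose M *v l) (N *v p7)"
      using p7 by (simp del: transpose_matrix_vector)
    show "nondegenerate_seventh (std_conic n) (N *v p1) (N *v p2) (N *v p3) (N *v p4) (N *v p5) (N *v p7)"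
      using nondegenerate unfolding C[symmetric] inv.nondegenerate_seventh_point .
  qed (use conic P p7 in \<open>simp_all flip: C\<close>)
  then obtain q6 q8 where q: "on_conic (std_conic n) q6" "on_conic (std_conic n) q8"
    and octagon: "poncelet_octagon (std_conic n)
      [N *v p1, N *v p2, N *v p3, N *v p4, N *v p5, q6, N *v p7, q8]"
    by blast
  have C_eq: "transpose N ** std_conic n ** N = C"
  proof -
    have "transpose N ** transpose M = mat 1"
      by (simp only: matrix_transpose_mul[symmetric] MN transpose_mat)
    then have "transpose N ** (transpose M ** C ** M) ** N = C"
      by (metis MN matrix_mul_assoc matrix_mul_lid matrix_mul_rid)
    then show ?thesis
      by (simp only: C)
  qed
  have "on_conic C (M *v q6)" "on_conic C (M *v q8)"
    using q on_conic_point[of "std_conic n"] by (simp_all add: C_eq)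
  moreover have "poncelet_octagon C [p1, p2, p3, p4, p5, M *v q6, p7, M *v q8]"
    using poncelet_octagon_point[OF octagon] by (simp add: C_eq)
  ultimately show ?thesis
    by blast
qed

end
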